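(* Let $N$ be an abelian group, $H$ a group, $\phi:H\to Sym(N)_1$ a group homomorphism, and $L=N\rtimes_\phi H$ the corresponding loop. Then $N_\rho(L)=N_\mu(L)$.
   Context: $Sym(N)_1$ is the stabilizer of the identity $1\in N$ in the group of all permutations of $N$; write $\phi_h=\phi(h)$. $N\rtimes_\phi H$ is the loop on $N\times H$ with operation $(n_1,h_1)(n_2,h_2)=(n_1\phi_{h_1}(n_2),h_1h_2)$. The right and middle nuclei of $L$ are $N_\rho(L)=\{a\in L\mid x(ya)=(xy)a\ \forall x,y\in L\}$ and $N_\mu(L)=\{a\in L\mid x(ay)=(xa)y\ \forall x,y\in L\}$. *)

theory Defs
  imports "HOL-Algebra.Group_Action"
begin

text \<open>Loops are records of type \<open>monoid\<close> (carrier, multiplication, unit) without associativity.\<close>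

locale loop =
  fixes L (structure)
  assumes m_closed [simp, intro]: "\<lbrakk>x \<in> carrier L; y \<in> carrier L\<rbrakk> \<Longrightarrow> x \<otimes> y \<in> carrier L"
    and one_closed [simp, intro]: "\<one> \<in> carrier L"
    and l_one [simp]: "x \<in> carrier L \<Longrightarrow> \<one> \<otimes> x = x"
    and r_one [simp]: "x \<in> carrier L \<Longrightarrow> x \<otimes> \<one> = x"
    and left_div: "\<lbrakk>a \<in> carrier L; b \<in> carrier L\<rbrakk> \<Longrightarrow> \<exists>!x. x \<in> carrier L \<and> a \<otimes> x = b"
    and right_div: "\<lbrakk>a \<in> carrier L; b \<in> carrier L\<rbrakk> \<Longrightarrow> \<exists>!y. y \<in> carrier L \<and> y \<otimes> a = b"

definition right_nucleus :: "('a, 'm) monoid_scheme \<Rightarrow> 'a set" where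
  "right_nucleus L = {a \<in> carrier L. \<forall>x\<in>carrier L. \<forall>y\<in>carrier L.
     x \<otimes>\<^bsub>L\<^esub> (y \<otimes>\<^bsub>L\<^esub> a) = (x \<otimes>\<^bsub>L\<^esub> y) \<otimes>\<^bsub>L\<^esub> a}"

definition middle_nucleus :: "('a, 'm) monoid_scheme \<Rightarrow> 'a set" where
  "middle_nucleus L = {a \<in> carrier L. \<forall>x\<in>carrier L. \<forall>y\<in>carrier L.
     x \<otimes>\<^bsub>L\<^esub> (a \<otimes>\<^bsub>L\<^esub> y) = (x \<otimes>\<^bsub>L\<^esub> a) \<otimes>\<^bsub>L\<^esub> y}"

text \<open>The product of \<open>BijGroup S\<close> is composition, \<open>(f \<otimes> g) n = f (g n)\<close>, so a homomorphism into
  it is a left action. Its elements are extensional: outside \<open>S\<close> they are \<open>undefined\<close>.\<close>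

definition Sym_one :: "('n, 'm) monoid_scheme \<Rightarrow> ('n \<Rightarrow> 'n) monoid" where
  "Sym_one N = (BijGroup (carrier N))
     \<lparr>carrier := stabilizer (BijGroup (carrier N)) (\<lambda>f. f) \<one>\<^bsub>N\<^esub>\<rparr>"

definition semidirect_loop ::
  "('n, 'm) monoid_scheme \<Rightarrow> ('h \<Rightarrow> 'n \<Rightarrow> 'n) \<Rightarrow> ('h, 'k) monoid_scheme \<Rightarrow> ('n \<times> 'h) monoid" where
  "semidirect_loop N \<phi> H =
     \<lparr>carrier = carrier N \<times> carrier H,
      mult = (\<lambda>(n\<^sub>1, h\<^sub>1) (n\<^sub>2, h\<^sub>2). (n\<^sub>1 \<otimes>\<^bsub>N\<^esub> \<phi> h\<^sub>1 n\<^sub>2, h\<^sub>1 \<otimes>\<^bsub>H\<^esub> h\<^sub>2)),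
      one = (\<one>\<^bsub>N\<^esub>, \<one>\<^bsub>H\<^esub>)\<rparr>"

lemma group_Sym_one:
  assumes "group N"
  shows "group (Sym_one N)"
proof -
  interpret N: group N by fact
  interpret B: group "BijGroup (carrier N)" by (rule group_BijGroup)
  have act: "group_action (BijGroup (carrier N)) (carrier N) (\<lambda>f. f)"
    unfolding group_action_def group_hom_def group_hom_axioms_def
    by (auto simp: group_BijGroup hom_def)
  have "subgroup (stabilizer (BijGroup (carrier N)) (\<lambda>f. f) \<one>\<^bsub>N\<^esub>) (BijGroup (carrier N))"
    using group_action.stabilizer_subgroup [OF act] by simp
  then show ?thesis
    unfolding Sym_one_def by (rule B.subgroup_imp_group)
qed

lemma loop_semidirect_loop:
  assumes "group N" and "group H" and \<phi>: "\<phi> \<in> hom H (Sym_one N)"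
  shows "loop (semidirect_loop N \<phi> H)"
proof -
  interpret N: group N by fact
  interpret H: group H by fact
  have mem: "\<phi> h \<in> Bij (carrier N)" "\<phi> h \<one>\<^bsub>N\<^esub> = \<one>\<^bsub>N\<^esub>" if "h \<in> carrier H" for h
    using \<phi> that by (auto simp: hom_def Sym_one_def stabilizer_def BijGroup_def)
  have bij: "bij_betw (\<phi> h) (carrier N) (carrier N)" if "h \<in> carrier H" for h
    using mem(1) [OF that] by (simp add: Bij_def)
  have cl: "\<phi> h n \<in> carrier N" if "h \<in> carrier H" "n \<in> carrier N" for h n
    using bij [OF that(1)] that(2) by (rule bij_betwE [rule_format])
  have "\<phi> \<one>\<^bsub>H\<^esub> = \<one>\<^bsub>Sym_one N\<^esub>"
    using \<phi> assms(2) group_Sym_one [OF assms(1)] by (rule hom_one)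
  then have id: "\<phi> \<one>\<^bsub>H\<^esub> n = n" if "n \<in> carrier N" for n
    using that by (simp add: Sym_one_def BijGroup_def)
  show ?thesis
  proof
    fix a b
    assume "a \<in> carrier (semidirect_loop N \<phi> H)" "b \<in> carrier (semidirect_loop N \<phi> H)"
    then obtain n h m k where ab: "a = (n, h)" "b = (m, k)"
      and c: "n \<in> carrier N" "m \<in> carrier N" "h \<in> carrier H" "k \<in> carrier H"
      by (auto simp: semidirect_loop_def)
    have im: "\<phi> h ` carrier N = carrier N" and inj: "inj_on (\<phi> h) (carrier N)"
      using bij [OF c(3)] by (auto simp: bij_betw_def)
    have "inv\<^bsub>N\<^esub> n \<otimes>\<^bsub>N\<^esub> m \<in> \<phi> h ` carrier N"
      unfolding im using c by simp
    then obtain x where x: "x \<in> carrier N" "\<phi> h x = inv\<^bsub>N\<^esub> n \<otimes>\<^bsub>N\<^esub> m" by (metis imageE)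
    show "\<exists>!x. x \<in> carrier (semidirect_loop N \<phi> H) \<and> a \<otimes>\<^bsub>semidirect_loop N \<phi> H\<^esub> x = b"
    proof (rule ex1I [of _ "(x, inv\<^bsub>H\<^esub> h \<otimes>\<^bsub>H\<^esub> k)"])
      show "(x, inv\<^bsub>H\<^esub> h \<otimes>\<^bsub>H\<^esub> k) \<in> carrier (semidirect_loop N \<phi> H) \<and>
          a \<otimes>\<^bsub>semidirect_loop N \<phi> H\<^esub> (x, inv\<^bsub>H\<^esub> h \<otimes>\<^bsub>H\<^esub> k) = b"
        using x c by (simp add: semidirect_loop_def ab N.m_assoc [symmetric] H.m_assoc [symmetric])
      fix z
      assume z: "z \<in> carrier (semidirect_loop N \<phi> H) \<and> a \<otimes>\<^bsub>semidirect_loop N \<phi> H\<^esub> z = b"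
      obtain z1 z2 where zz: "z = (z1, z2)" by fastforce
      have e: "z1 \<in> carrier N" "z2 \<in> carrier H" "n \<otimes>\<^bsub>N\<^esub> \<phi> h z1 = m" "h \<otimes>\<^bsub>H\<^esub> z2 = k"
        using z by (auto simp: semidirect_loop_def zz ab)
      have "\<phi> h z1 = inv\<^bsub>N\<^esub> n \<otimes>\<^bsub>N\<^esub> m"
        using c cl [OF c(3) e(1)] by (simp add: e(3) [symmetric] N.m_assoc [symmetric])
      then have "z1 = x"
        using inj_onD [OF inj _ e(1) x(1)] x(2) by simp
      moreover have "z2 = inv\<^bsub>H\<^esub> h \<otimes>\<^bsub>H\<^esub> k"
        using c e(2) by (simp add: e(4) [symmetric] H.m_assoc [symmetric])
      ultimately show "z = (x, inv\<^bsub>H\<^esub> h \<otimes>\<^bsub>H\<^esub> k)"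
        using zz by simp
    qed
    let ?h = "k \<otimes>\<^bsub>H\<^esub> inv\<^bsub>H\<^esub> h"
    let ?n = "m \<otimes>\<^bsub>N\<^esub> inv\<^bsub>N\<^esub> (\<phi> ?h n)"
    show "\<exists>!y. y \<in> carrier (semidirect_loop N \<phi> H) \<and> y \<otimes>\<^bsub>semidirect_loop N \<phi> H\<^esub> a = b"
    proof (rule ex1I [of _ "(?n, ?h)"])
      show "(?n, ?h) \<in> carrier (semidirect_loop N \<phi> H) \<and>
          (?n, ?h) \<otimes>\<^bsub>semidirect_loop N \<phi> H\<^esub> a = b"
        using c by (simp add: semidirect_loop_def ab N.m_assoc H.m_assoc cl)
      fix z
      assume z: "z \<in> carrier (semidirect_loop N \<phi> H) \<and> z \<otimes>\<^bsub>semidirect_loop N \<phi> H\<^esub> a = b"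
      obtain z1 z2 where zz: "z = (z1, z2)" by fastforce
      have e: "z1 \<in> carrier N" "z2 \<in> carrier H" "z1 \<otimes>\<^bsub>N\<^esub> \<phi> z2 n = m" "z2 \<otimes>\<^bsub>H\<^esub> h = k"
        using z by (auto simp: semidirect_loop_def zz ab)
      have z2: "z2 = ?h"
        using c e(2) by (simp add: e(4) [symmetric] H.m_assoc)
      have "z1 = m \<otimes>\<^bsub>N\<^esub> inv\<^bsub>N\<^esub> (\<phi> z2 n)"
        using c e(1) cl [OF e(2) c(1)] by (simp add: e(3) [symmetric] N.m_assoc)
      then show "z = (?n, ?h)" using zz z2 by simp
    qed
  qed (auto simp: semidirect_loop_def cl id mem(2))
qed

end

theory Submission
  imports Defs
begin

text \<open>
  Write \<open>\<phi>\<^sub>h\<close> for \<open>\<phi> h\<close>. For an arbitrary group \<open>N\<close> both nuclei are described by the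
  first component \<open>c\<close> of their elements \<open>(c, g)\<close>, with \<open>g\<close> free. The associativity law of the
  middle nucleus becomes \<open>\<phi>\<^sub>h (c \<phi>\<^sub>g(n)) = \<phi>\<^sub>h(c) \<phi>\<^sub>h(\<phi>\<^sub>g(n))\<close>, and since \<open>\<phi>\<^sub>g\<close> is onto, this says
  that every \<open>\<phi>\<^sub>h\<close> is multiplicative on products with left factor \<open>c\<close>
  (\<open>middle_nucleus_semidirect_loop\<close>). The law of the right nucleus becomes
  \<open>\<phi>\<^sub>h (n \<phi>\<^sub>k(c)) = \<phi>\<^sub>h(n) \<phi>\<^sub>h(\<phi>\<^sub>k(c))\<close>. Taking \<open>k = 1\<close>, every \<open>\<phi>\<^sub>h\<close> is multiplicative on products
  with right factor \<open>c\<close>. This special case gives back the whole law, because the set of such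
  \<open>c\<close> is invariant under the action (\<open>right_nucleus_semidirect_loop\<close>). When \<open>N\<close> is abelian, left
  and right factors can be exchanged, and the two descriptions coincide.
\<close>

locale unital_permutation_action =
  N: group N + H: group H
  for N :: "('n, 'm) monoid_scheme" and H :: "('h, 'k) monoid_scheme" +
  fixes \<phi> :: "'h \<Rightarrow> 'n \<Rightarrow> 'n"
  assumes action_hom: "\<phi> \<in> hom H (Sym_one N)"
begin

lemma action_bij_betw:
  assumes "h \<in> carrier H"
  shows "bij_betw (\<phi> h) (carrier N) (carrier N)"
  using action_hom assms
  by (auto simp: hom_def Sym_one_def stabilizer_def BijGroup_def Bij_def)

lemma action_closed [simp]:
  assumes "h \<in> carrier H" and "n \<in> carrier N"
  shows "\<phi> h n \<in> carrier N"
  using bij_betwE [OF action_bij_betw [OF assms(1)]] assms(2) by blast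

lemma action_surj:
  assumes "h \<in> carrier H" and "n \<in> carrier N"
  obtains n' where "n' \<in> carrier N" and "n = \<phi> h n'"
  using bij_betw_imp_surj_on [OF action_bij_betw [OF assms(1)]] assms(2) by blast

lemma action_one:
  assumes "n \<in> carrier N"
  shows "\<phi> \<one>\<^bsub>H\<^esub> n = n"
proof -
  have "\<phi> \<one>\<^bsub>H\<^esub> = \<one>\<^bsub>Sym_one N\<^esub>"
    using action_hom H.group_axioms group_Sym_one [OF N.group_axioms] by (rule hom_one)
  then show ?thesis
    using assms by (simp add: Sym_one_def BijGroup_def)
qed

lemma action_mult:
  assumes "h \<in> carrier H" and "k \<in> carrier H" and "n \<in> carrier N"
  shows "\<phi> (h \<otimes>\<^bsub>H\<^esub> k) n = \<phi> h (\<phi> k n)"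
proof -
  have "\<phi> h \<in> Bij (carrier N)" "\<phi> k \<in> Bij (carrier N)"
    using action_hom assms(1,2)
    by (auto simp: hom_def Sym_one_def stabilizer_def BijGroup_def)
  moreover have "\<phi> (h \<otimes>\<^bsub>H\<^esub> k) = \<phi> h \<otimes>\<^bsub>Sym_one N\<^esub> \<phi> k"
    using action_hom assms(1,2) by (simp add: hom_mult)
  ultimately show ?thesis
    using assms(3) by (simp add: Sym_one_def BijGroup_def compose_def)
qed

text \<open>
  If all \<open>\<phi>\<^sub>h\<close> respect products with right factor \<open>c\<close>, then they also respect products with right
  factor \<open>\<phi>\<^sub>k(c)\<close>: write the left factor as \<open>\<phi>\<^sub>k(n')\<close>, use the hypothesis for \<open>\<phi>\<^sub>k\<close> to merge the
  product into \<open>\<phi>\<^sub>k(n' c)\<close>, and then use it for \<open>\<phi>\<^sub>h\<^sub>k\<close>.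
\<close>

lemma respects_right_factor_invariant:
  assumes c: "c \<in> carrier N"
    and right: "\<And>h n. \<lbrakk>h \<in> carrier H; n \<in> carrier N\<rbrakk> \<Longrightarrow>
      \<phi> h (n \<otimes>\<^bsub>N\<^esub> c) = \<phi> h n \<otimes>\<^bsub>N\<^esub> \<phi> h c"
    and h: "h \<in> carrier H" and k: "k \<in> carrier H" and n: "n \<in> carrier N"
  shows "\<phi> h (n \<otimes>\<^bsub>N\<^esub> \<phi> k c) = \<phi> h n \<otimes>\<^bsub>N\<^esub> \<phi> h (\<phi> k c)"
proof -
  obtain n' where n': "n' \<in> carrier N" "n = \<phi> k n'"
    using action_surj [OF k n] .
  have "\<phi> h (n \<otimes>\<^bsub>N\<^esub> \<phi> k c) = \<phi> h (\<phi> k (n' \<otimes>\<^bsub>N\<^esub> c))"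
    using n' k by (simp add: right)
  also have "\<dots> = \<phi> (h \<otimes>\<^bsub>H\<^esub> k) (n' \<otimes>\<^bsub>N\<^esub> c)"
    using n' c h k by (simp add: action_mult)
  also have "\<dots> = \<phi> (h \<otimes>\<^bsub>H\<^esub> k) n' \<otimes>\<^bsub>N\<^esub> \<phi> (h \<otimes>\<^bsub>H\<^esub> k) c"
    using n' h k by (simp add: right)
  also have "\<dots> = \<phi> h n \<otimes>\<^bsub>N\<^esub> \<phi> h (\<phi> k c)"
    using n' c h k by (simp add: action_mult)
  finally show ?thesis .
qed

text \<open>
  In \<open>x (y a) = (x y) a\<close> the second components agree because \<open>H\<close> is associative, and the first
  component of \<open>x\<close> cancels in \<open>N\<close>. What remains only involves the second components of \<open>x\<close> and \<open>y\<close>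
  and the first components of \<open>y\<close> and \<open>a\<close>.
\<close>

lemma right_nucleus_semidirect_loop_iff:
  "(c, g) \<in> right_nucleus (semidirect_loop N \<phi> H) \<longleftrightarrow>
     c \<in> carrier N \<and> g \<in> carrier H \<and>
     (\<forall>h\<in>carrier H. \<forall>k\<in>carrier H. \<forall>n\<in>carrier N.
        \<phi> h (n \<otimes>\<^bsub>N\<^esub> \<phi> k c) = \<phi> h n \<otimes>\<^bsub>N\<^esub> \<phi> h (\<phi> k c))"
  by (auto simp: right_nucleus_def semidirect_loop_def action_mult N.m_assoc H.m_assoc)

lemma middle_nucleus_semidirect_loop_iff:
  "(c, g) \<in> middle_nucleus (semidirect_loop N \<phi> H) \<longleftrightarrow>
     c \<in> carrier N \<and> g \<in> carrier H \<and>
     (\<forall>h\<in>carrier H. \<forall>n\<in>carrier N.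
        \<phi> h (c \<otimes>\<^bsub>N\<^esub> \<phi> g n) = \<phi> h c \<otimes>\<^bsub>N\<^esub> \<phi> h (\<phi> g n))"
  by (auto simp: middle_nucleus_def semidirect_loop_def action_mult N.m_assoc H.m_assoc)

lemma right_nucleus_semidirect_loop:
  "right_nucleus (semidirect_loop N \<phi> H) =
     {c \<in> carrier N. \<forall>h\<in>carrier H. \<forall>n\<in>carrier N.
        \<phi> h (n \<otimes>\<^bsub>N\<^esub> c) = \<phi> h n \<otimes>\<^bsub>N\<^esub> \<phi> h c} \<times> carrier H"
proof -
  have "(\<forall>h\<in>carrier H. \<forall>k\<in>carrier H. \<forall>n\<in>carrier N.
          \<phi> h (n \<otimes>\<^bsub>N\<^esub> \<phi> k c) = \<phi> h n \<otimes>\<^bsub>N\<^esub> \<phi> h (\<phi> k c)) \<longleftrightarrow>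
        (\<forall>h\<in>carrier H. \<forall>n\<in>carrier N. \<phi> h (n \<otimes>\<^bsub>N\<^esub> c) = \<phi> h n \<otimes>\<^bsub>N\<^esub> \<phi> h c)"
    (is "?law \<longleftrightarrow> ?right") if c: "c \<in> carrier N" for c
  proof
    assume ?law
    then show ?right
      using action_one [OF c] H.one_closed by metis
  next
    assume ?right
    then show ?law
      using respects_right_factor_invariant [OF c] by blast
  qed
  then show ?thesis
    by (auto simp: right_nucleus_semidirect_loop_iff)
qed

lemma middle_nucleus_semidirect_loop:
  "middle_nucleus (semidirect_loop N \<phi> H) =
     {c \<in> carrier N. \<forall>h\<in>carrier H. \<forall>n\<in>carrier N.
        \<phi> h (c \<otimes>\<^bsub>N\<^esub> n) = \<phi> h c \<otimes>\<^bsub>N\<^esub> \<phi> h n} \<times> carrier H"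
proof -
  have reindex: "(\<forall>n\<in>carrier N. P (\<phi> g n)) \<longleftrightarrow> (\<forall>n\<in>carrier N. P n)"
    if "g \<in> carrier H" for g and P :: "'n \<Rightarrow> bool"
    using action_surj [OF that] action_closed [OF that] by metis
  have "(c, g) \<in> middle_nucleus (semidirect_loop N \<phi> H) \<longleftrightarrow>
      c \<in> carrier N \<and> g \<in> carrier H \<and>
      (\<forall>h\<in>carrier H. \<forall>n\<in>carrier N. \<phi> h (c \<otimes>\<^bsub>N\<^esub> n) = \<phi> h c \<otimes>\<^bsub>N\<^esub> \<phi> h n)" for c g
    unfolding middle_nucleus_semidirect_loop_iff
    using reindex [of g "\<lambda>n. \<phi> _ (c \<otimes>\<^bsub>N\<^esub> n) = \<phi> _ c \<otimes>\<^bsub>N\<^esub> \<phi> _ n"] by blast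
  then show ?thesis
    by auto
qed

end

theorem proposition3p9:
  fixes N :: "('n, 'm) monoid_scheme" and H :: "('h, 'k) monoid_scheme"
    and \<phi> :: "'h \<Rightarrow> 'n \<Rightarrow> 'n"
  assumes "comm_group N" and "group H" and "\<phi> \<in> hom H (Sym_one N)"
  shows "right_nucleus (semidirect_loop N \<phi> H) = middle_nucleus (semidirect_loop N \<phi> H)"
proof -
  interpret N: comm_group N by fact
  interpret unital_permutation_action N H \<phi>
    using N.group_axioms assms(2,3)
    by (simp add: unital_permutation_action_def unital_permutation_action_axioms_def)
  have "\<phi> h (n \<otimes>\<^bsub>N\<^esub> c) = \<phi> h n \<otimes>\<^bsub>N\<^esub> \<phi> h c \<longleftrightarrow>
      \<phi> h (c \<otimes>\<^bsub>N\<^esub> n) = \<phi> h c \<otimes>\<^bsub>N\<^esub> \<phi> h n"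
    if "h \<in> carrier H" "n \<in> carrier N" "c \<in> carrier N" for h n c
    using that by (simp add: N.m_comm)
  then show ?thesis
    unfolding right_nucleus_semidirect_loop middle_nucleus_semidirect_loop by blast
qed

end
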